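(* Let $n \ge 1$ be an integer and let $a \geq 2$ be an integer. Let $f$ be a real $1$-periodic function which is expandable as a Fourier series. Then $f$ is a solution of the functional equation $(E_{n,a})$, $$f(a x) = a^{n-1} \sum_{k=0}^{a-1} f\left(x + \frac{k}{a}\right),$$ if and only if it has the form $$f(x) = \sum_{k=1}^{+\infty} \left(u_k \frac{\cos(2\pi k x)}{k^n} + v_k \frac{\sin(2\pi k x)}{k^n}\right),$$ where $(u_k)_{k \geq 1}$ and $(v_k)_{k \geq 1}$ are real sequences which satisfy $u_{ak} = u_k$ and $v_{ak} = v_k$ for every integer $k \ge 1$.
   Context: "$f$ is expandable as a Fourier series" means that there are complex numbers $(\alpha_k)_{k\in\mathbb{Z}}$ such that $f(x) = \sum_{k \in \mathbb{Z}} \alpha_k e^{2\pi i k x}$ at every point $x$ of the domain of $f$, the series being convergent in the sense of symmetric partial sums $\sum_{|k|\le N}$, $N\to\infty$. The domain of $f$ is $\mathbb{R}$; when $n=1$ the domain is also allowed to be $\mathbb{R}\setminus\mathbb{Z}$ (e.g. $f(x)=\log(2|\sin(\pi x)|)$). All identities, including $(E_{n,a})$, are understood for all real $x$ when the domain is $\mathbb{R}$; when the domain is $\mathbb{R}\setminus\mathbb{Z}$, the expansion of $f$ is understood for all $x\in\mathbb{R}\setminus\mathbb{Z}$ and $(E_{n,a})$ for all real $x$ with $ax\notin\mathbb{Z}$. *)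

theory Defs
  imports Complex_Main
begin

text \<open>A function with domain D is a total function on the reals whose values outside D are
  never used. The set of all reals is always allowed as a domain, the complement of the integers
  only for n = 1.\<close>

definition admissible_domain :: "nat \<Rightarrow> real set \<Rightarrow> bool" where
  "admissible_domain n D \<longleftrightarrow> D = UNIV \<or> (n = 1 \<and> D = - \<int>)"

definition one_periodic_on :: "real set \<Rightarrow> (real \<Rightarrow> real) \<Rightarrow> bool" where
  "one_periodic_on D f \<longleftrightarrow> (\<forall>x\<in>D. f (x + 1) = f x)"

definition fourier_expandable_on :: "real set \<Rightarrow> (real \<Rightarrow> real) \<Rightarrow> bool" where
  "fourier_expandable_on D f \<longleftrightarrow>
     (\<exists>\<alpha> :: int \<Rightarrow> complex. \<forall>x\<in>D.
        (\<lambda>N. \<Sum>k = - int N..int N. \<alpha> k * exp (2 * pi * \<i> * of_int k * of_real x))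
          \<longlonglongrightarrow> complex_of_real (f x))"

text \<open>For both admissible domains, a * x \<in> D implies that every x + k / a lies in D, so only
  values of f on D occur below.\<close>

definition solves_equation :: "nat \<Rightarrow> nat \<Rightarrow> real set \<Rightarrow> (real \<Rightarrow> real) \<Rightarrow> bool" where
  "solves_equation n a D f \<longleftrightarrow>
     (\<forall>x. real a * x \<in> D \<longrightarrow>
        f (real a * x) = real a ^ (n - 1) * (\<Sum>k = 0..a - 1. f (x + real k / real a)))"

end

theory Submission
  imports Defs "HOL-Probability.Sinc_Integral"
begin

text \<open>
  Write f as a real series with terms A k cos (2 pi k x) + B k sin (2 pi k x), where k runs over
  the natural numbers. Averaging this series over the translates x + j/a annihilates every
  frequency that is not a multiple of a and keeps the others, because the a-th roots of unity sum
  to 0. The right-hand side of the functional equation is therefore the trigonometric series in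
  y = a x whose m-th coefficients are \<open>a ^ n * A (a * m)\<close> and \<open>a ^ n * B (a * m)\<close>
  (\<open>sums_average_translates\<close>). If these agree with \<open>A m\<close> and \<open>B m\<close>, the equation holds.
  Conversely, if the equation holds then the difference of the two series is a trigonometric series
  that converges to 0 at every point of D, and the coefficients agree as soon as such a
  series can only be the zero series. The relation at m = 0 gives \<open>A 0 = 0\<close>, and the
  substitution \<open>u k = k ^ n * A k\<close>, \<open>v k = k ^ n * B k\<close> turns the other relations into
  the invariance of u and v under multiplication of the index by a.

  The analytic core is thus Cantor's uniqueness theorem (\<open>cantor_uniqueness\<close>), in the form that
  allows the series to diverge at the integers, as it may when D is the complement of the integers.
  In the variable t = 2 pi x the terms of the null series are
  a k cos (k t) + b k sin (k t). Its coefficients tend to 0 (\<open>cantor_lebesgue\<close>), so integrating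
  it twice term by term gives a continuous 2 pi-periodic function -F plus the quadratic
  term a 0 t^2 / 2. Riemann's summation method (\<open>riemann_summation\<close>) shows that this sum G has
  second symmetric derivative 0 on the open interval from 0 to 2 pi, hence is affine there by
  Schwarz's lemma (\<open>schwarz_affine\<close>). So F agrees on a full period with a quadratic polynomial.
  Comparing Fourier coefficients, b m = 0 and a m = 2 a 0 for all \<open>m \<ge> 1\<close>. These are the
  coefficients of a multiple of the Dirac comb, a distribution concentrated on the excluded points,
  and the multiple is 0 because a tends to 0.
\<close>

section \<open>Riemann's summation method\<close>

text \<open>The factor by which the k-th term of a trigonometric series gets multiplied, at the
  point k h, when the series is integrated twice and a second difference quotient of step 2 h is
  taken instead of a second derivative.\<close>

definition riemann_kernel :: "real \<Rightarrow> real" where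
  "riemann_kernel x = (sinc x)\<^sup>2"

lemma riemann_kernel_0 [simp]: "riemann_kernel 0 = 1"
  by (simp add: riemann_kernel_def)

lemma riemann_kernel_abs_le_1: "\<bar>riemann_kernel x\<bar> \<le> 1"
proof (cases "x = 0")
  case False
  have "\<bar>sin x / x\<bar> \<le> 1"
    using False abs_sin_x_le_abs_x[of x] by (simp add: abs_divide divide_le_eq)
  then show ?thesis
    using False by (simp add: riemann_kernel_def abs_square_le_1 del: abs_divide)
qed simp

lemma riemann_kernel_deriv:
  assumes "x > 0"
  shows "(riemann_kernel has_real_derivative 2 * (sin x / x) * ((x * cos x - sin x) / x\<^sup>2)) (at x)"
proof -
  have "((\<lambda>x. (sin x / x)\<^sup>2) has_real_derivative
          2 * (sin x / x) * ((x * cos x - sin x) / x\<^sup>2)) (at x)"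
    using assms by (auto intro!: derivative_eq_intros simp: power2_eq_square field_simps)
  then show ?thesis
  proof (rule has_field_derivative_transform_within_open[where S = "{0<..}"])
    show "\<And>y. y \<in> {0<..} \<Longrightarrow> (sin y / y)\<^sup>2 = riemann_kernel y"
      by (simp add: riemann_kernel_def)
  qed (use assms in auto)
qed

text \<open>Near 0 the numerator x cos x - sin x is at most x^2 by the mean value theorem; away
  from 0 the trivial estimates give decay of order 1/x^2. The bound is a multiple of the derivative
  of arctan.\<close>

lemma riemann_kernel_deriv_bound:
  fixes x :: real
  assumes "x > 0"
  shows "\<bar>2 * (sin x / x) * ((x * cos x - sin x) / x\<^sup>2)\<bar> \<le> 8 / (1 + x\<^sup>2)"
proof (cases "x \<le> 1")
  case True
  have 1: "\<bar>sin x / x\<bar> \<le> 1"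
    using assms abs_sin_x_le_abs_x[of x] by (simp add: abs_divide divide_le_eq)
  have "\<exists>z. 0 < z \<and> z < x \<and> (x * cos x - sin x) - (0 * cos 0 - sin 0) = (x - 0) * (- (z * sin z))"
    using assms by (intro MVT2) (auto intro!: derivative_eq_intros)
  then obtain z where z: "0 < z" "z < x" "x * cos x - sin x = - (x * (z * sin z))"
    by auto
  have "\<bar>z * sin z\<bar> \<le> x * 1"
    unfolding abs_mult using z by (intro mult_mono) auto
  then have "\<bar>x * cos x - sin x\<bar> \<le> x\<^sup>2"
    using assms unfolding z(3) by (simp add: abs_mult power2_eq_square)
  then have 2: "\<bar>(x * cos x - sin x) / x\<^sup>2\<bar> \<le> 1"
    using assms by (simp add: abs_divide divide_le_eq)
  have "\<bar>(sin x / x) * ((x * cos x - sin x) / x\<^sup>2)\<bar> \<le> 1 * 1"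
    unfolding abs_mult using 1 2 by (intro mult_mono) auto
  then have "\<bar>2 * (sin x / x) * ((x * cos x - sin x) / x\<^sup>2)\<bar> \<le> 2"
    unfolding mult.assoc abs_mult[of 2] by simp
  also have "2 \<le> 8 / (1 + x\<^sup>2)"
    using True assms power_le_one[of x 2] by (simp add: field_simps add_pos_pos)
  finally show ?thesis .
next
  case False
  have "\<bar>x * cos x - sin x\<bar> \<le> \<bar>x * cos x\<bar> + \<bar>sin x\<bar>"
    by simp
  also have "\<dots> \<le> x * 1 + x"
    unfolding abs_mult using False assms abs_sin_x_le_abs_x[of x]
    by (intro add_mono mult_mono) auto
  finally have 1: "\<bar>x * cos x - sin x\<bar> \<le> 2 * x" by simp
  have "\<bar>sin x\<bar> * \<bar>x * cos x - sin x\<bar> \<le> 1 * (2 * x)"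
    using 1 by (intro mult_mono) auto
  then have "2 * (\<bar>sin x\<bar> * \<bar>x * cos x - sin x\<bar>) / (x * x\<^sup>2) \<le> 2 * (1 * (2 * x)) / (x * x\<^sup>2)"
    using assms by (intro divide_right_mono mult_left_mono) auto
  then have "\<bar>2 * (sin x / x) * ((x * cos x - sin x) / x\<^sup>2)\<bar> \<le> 2 * (1 * (2 * x)) / (x * x\<^sup>2)"
    using assms by (simp add: abs_mult abs_divide)
  also have "\<dots> = 4 / x\<^sup>2"
    using assms by (simp add: field_simps power2_eq_square)
  also have "\<dots> \<le> 8 / (1 + x\<^sup>2)"
    using False one_le_power[of x 2] by (simp add: field_simps add_pos_pos)
  finally show ?thesis .
qed

text \<open>The kernel has bounded variation on the half-line. Dominating its increments by those of
  a bounded monotone function makes sums of increments along any grid telescope.\<close>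

lemma riemann_kernel_variation:
  assumes "0 \<le> x" "x \<le> y"
  shows "\<bar>riemann_kernel y - riemann_kernel x\<bar> \<le> 8 * (arctan y - arctan x)"
proof -
  have cont: "continuous_on {x..y} riemann_kernel"
    unfolding riemann_kernel_def by (intro continuous_intros)
  have "8 * arctan x + s * riemann_kernel x \<le> 8 * arctan y + s * riemann_kernel y"
    if "\<bar>s\<bar> = 1" for s :: real
  proof (rule DERIV_nonneg_imp_increasing_open[OF assms(2)])
    fix z assume z: "x < z" "z < y"
    then have "z > 0" using assms by simp
    let ?d = "2 * (sin z / z) * ((z * cos z - sin z) / z\<^sup>2)"
    have "((\<lambda>z. 8 * arctan z + s * riemann_kernel z) has_real_derivative
            8 / (1 + z\<^sup>2) + s * ?d) (at z)"
      using riemann_kernel_deriv[OF \<open>z > 0\<close>]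
      by (auto intro!: derivative_eq_intros simp: field_simps)
    moreover have "\<bar>s * ?d\<bar> \<le> 8 / (1 + z\<^sup>2)"
      unfolding abs_mult[of s] that using riemann_kernel_deriv_bound[OF \<open>z > 0\<close>] by simp
    then have "8 / (1 + z\<^sup>2) + s * ?d \<ge> 0" by linarith
    ultimately show "\<exists>d. ((\<lambda>z. 8 * arctan z + s * riemann_kernel z) has_real_derivative d) (at z)
        \<and> 0 \<le> d" by blast
  next
    show "continuous_on {x..y} (\<lambda>z. 8 * arctan z + s * riemann_kernel z)"
      by (intro continuous_intros cont)
  qed
  from this[of 1] this[of "-1"] show ?thesis by (simp add: algebra_simps abs_le_iff)
qed

text \<open>Riemann's method is regular. Summation by parts turns the kernel sum into
  a sum of partial sums s weighted by increments of the kernel. The late partial sums are small and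
  the total weight is bounded by the variation of the kernel; the finitely many early ones
  get the weight of the kernel on the shrinking interval from 0 to M h, which tends to 0.\<close>

lemma riemann_summation:
  fixes c :: "nat \<Rightarrow> real"
  assumes c: "c sums 0"
    and r: "\<And>h. h > 0 \<Longrightarrow> (\<lambda>k. c k * riemann_kernel (real k * h)) sums r h"
  shows "(r \<longlongrightarrow> 0) (at_right 0)"
proof (rule tendstoI)
  fix e :: real assume e: "e > 0"
  \<comment> \<open>The tail contributes at most 16 times \<delta>, as 8 bounds the increments relative to arctan
     and arctan is at most 2; the initial part is made less than another 16 times \<delta>.\<close>
  define \<delta> where "\<delta> = e / 32"
  have \<delta>: "\<delta> > 0" using e by (simp add: \<delta>_def)
  define s where "s N = (\<Sum>k<N. c k)" for N
  have s0: "s \<longlonglongrightarrow> 0" using c by (simp add: sums_def s_def[abs_def])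
  then have "Bseq s" by (auto intro: convergent_imp_Bseq convergentI)
  then obtain B where B: "B > 0" "\<And>k. \<bar>s k\<bar> \<le> B"
    by (auto simp: Bseq_def)
  obtain M where M: "\<And>k. k \<ge> M \<Longrightarrow> \<bar>s k\<bar> < \<delta>"
    using s0 \<delta> by (auto simp: lim_sequentially dist_real_def)
  have bound: "\<bar>r h\<bar> \<le> 8 * B * arctan (real M * h) + 16 * \<delta>" if h: "h > 0" for h
  proof -
    define K where "K k = riemann_kernel (real k * h)" for k
    define T where "T k = arctan (real k * h)" for k
    have abel: "(\<Sum>k<N. c k * K k) = s N * K N + (\<Sum>k<N. s (Suc k) * (K k - K (Suc k)))" for N
      by (induction N) (simp_all add: s_def algebra_simps)
    have var: "\<bar>K k - K (Suc k)\<bar> \<le> 8 * (T (Suc k) - T k)" for k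
      using riemann_kernel_variation[of "real k * h" "real (Suc k) * h"] h
      by (simp add: K_def T_def abs_minus_commute mult_right_mono)
    have T: "T k \<le> 2" "0 \<le> T k" for k
      using arctan_ubound[of "real k * h"] pi_less_4 h by (auto simp: T_def)
    have "(\<Sum>k<N. \<bar>s (Suc k) * (K k - K (Suc k))\<bar>) \<le> 8 * B * T M + 8 * \<delta> * (T N - T M)"
      if "N \<ge> M" for N
      using that
    proof (induction N rule: dec_induct)
      case base
      have "(\<Sum>k<M. \<bar>s (Suc k) * (K k - K (Suc k))\<bar>) \<le> (\<Sum>k<M. B * (8 * (T (Suc k) - T k)))"
        unfolding abs_mult using B var by (intro sum_mono mult_mono) auto
      also have "\<dots> = 8 * B * (T M - T 0)"
        by (simp only: sum_distrib_left[symmetric] sum_lessThan_telescope)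
      finally show ?case by (simp add: T_def)
    next
      case (step N)
      have "\<bar>s (Suc N) * (K N - K (Suc N))\<bar> \<le> \<delta> * (8 * (T (Suc N) - T N))"
        unfolding abs_mult using M[of "Suc N"] step(1) var \<delta> by (intro mult_mono) auto
      then show ?case using step by (simp add: algebra_simps)
    qed
    moreover have "8 * \<delta> * (T N - T M) \<le> 8 * \<delta> * 2" for N
      using T(1)[of N] T(2)[of M] \<delta> by (intro mult_left_mono) auto
    ultimately have tail: "(\<Sum>k<N. \<bar>s (Suc k) * (K k - K (Suc k))\<bar>) \<le> 8 * B * T M + 16 * \<delta>"
      if "N \<ge> M" for N using that by (smt (verit))
    have "\<bar>\<Sum>k<N. c k * K k\<bar> \<le> \<bar>s N\<bar> + (8 * B * T M + 16 * \<delta>)" if "N \<ge> M" for N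
    proof -
      have "\<bar>s N * K N\<bar> \<le> \<bar>s N\<bar> * 1"
        unfolding abs_mult K_def by (intro mult_left_mono riemann_kernel_abs_le_1) auto
      moreover have "\<bar>\<Sum>k<N. s (Suc k) * (K k - K (Suc k))\<bar>
          \<le> (\<Sum>k<N. \<bar>s (Suc k) * (K k - K (Suc k))\<bar>)" by (rule sum_abs)
      ultimately show ?thesis
        using tail[OF that] unfolding abel by linarith
    qed
    moreover have "(\<lambda>N. \<bar>\<Sum>k<N. c k * K k\<bar>) \<longlonglongrightarrow> \<bar>r h\<bar>"
      using r[OF h] unfolding sums_def K_def by (intro tendsto_rabs)
    moreover have "(\<lambda>N. \<bar>s N\<bar> + (8 * B * T M + 16 * \<delta>)) \<longlonglongrightarrow> 0 + (8 * B * T M + 16 * \<delta>)"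
      using s0 by (intro tendsto_intros tendsto_rabs_zero)
    ultimately have "\<bar>r h\<bar> \<le> 0 + (8 * B * T M + 16 * \<delta>)"
      by (intro LIMSEQ_le) auto
    then show ?thesis by (simp add: T_def)
  qed
  have "((\<lambda>h. 8 * B * arctan (real M * h)) \<longlongrightarrow> 8 * B * arctan (real M * 0)) (at_right 0)"
    by (intro tendsto_intros)
  then have "eventually (\<lambda>h. 8 * B * arctan (real M * h) < 16 * \<delta>) (at_right 0)"
    using \<delta> by (intro order_tendstoD(2)[where y = "8 * B * arctan (real M * 0)"]) auto
  moreover have "eventually (\<lambda>h. h > 0) (at_right (0::real))"
    by (simp add: eventually_at_right_less)
  ultimately show "eventually (\<lambda>h. dist (r h) 0 < e) (at_right 0)"
  proof eventually_elim
    case (elim h)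
    then show ?case using bound[of h] by (simp add: \<delta>_def)
  qed
qed

section \<open>Functions with vanishing second symmetric derivative\<close>

text \<open>If G were positive somewhere, subtracting a small concave parabola vanishing at the
  endpoints would leave a positive interior maximum. There second differences are at
  most 0, while the parabola contributes a strictly positive constant to the second symmetric
  derivative of G.\<close>

lemma schwarz_upper_bound:
  fixes G :: "real \<Rightarrow> real"
  assumes ab: "a < b" and cont: "continuous_on {a..b} G"
    and G0: "G a = 0" "G b = 0"
    and lim: "\<And>t. a < t \<Longrightarrow> t < b \<Longrightarrow>
      ((\<lambda>h. (G (t + h) + G (t - h) - 2 * G t) / h\<^sup>2) \<longlongrightarrow> 0) (at_right 0)"
    and t: "a \<le> t" "t \<le> b"
  shows "G t \<le> 0"
proof (rule ccontr)
  assume pos: "\<not> G t \<le> 0"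
  then have t': "a < t" "t < b" using t G0 by (cases "t = a"; cases "t = b"; auto)+
  \<comment> \<open>With this e the parabola takes exactly half the value of G at t.\<close>
  define e where "e = G t / (2 * ((t - a) * (b - t)))"
  have e: "e > 0" using pos t' by (simp add: e_def)
  define H where "H x = G x - e * ((x - a) * (b - x))" for x
  have Ht: "H t > 0" using pos t' by (simp add: H_def e_def)
  have "continuous_on {a..b} H"
    unfolding H_def by (intro continuous_intros cont)
  then obtain z where z: "z \<in> {a..b}" "\<And>y. y \<in> {a..b} \<Longrightarrow> H y \<le> H z"
    using continuous_attains_sup[of "{a..b}" H] ab by auto
  have "H z > 0" using z(2)[of t] Ht t by auto
  then have z': "a < z" "z < b" using z(1) G0 by (cases "z = a"; cases "z = b"; auto simp: H_def)+
  have "((\<lambda>h. (G (z + h) + G (z - h) - 2 * G z) / h\<^sup>2 + 2 * e) \<longlongrightarrow> 0 + 2 * e) (at_right 0)"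
    by (intro tendsto_intros lim z')
  moreover have "eventually (\<lambda>h. (G (z + h) + G (z - h) - 2 * G z) / h\<^sup>2 + 2 * e \<le> 0) (at_right 0)"
  proof -
    have "eventually (\<lambda>h. h \<in> {0<..<min (z - a) (b - z)}) (at_right 0)"
      using z' by (intro eventually_at_right_real) auto
    then show ?thesis
    proof eventually_elim
      case (elim h)
      have "H (z + h) + H (z - h) - 2 * H z \<le> 0"
        using z(2)[of "z + h"] z(2)[of "z - h"] elim by auto
      moreover have "H (z + h) + H (z - h) - 2 * H z = G (z + h) + G (z - h) - 2 * G z + 2 * e * h\<^sup>2"
        by (simp add: H_def algebra_simps power2_eq_square)
      ultimately have "(G (z + h) + G (z - h) - 2 * G z + 2 * e * h\<^sup>2) / h\<^sup>2 \<le> 0"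
        by (simp add: divide_le_0_iff)
      then show ?case using elim by (simp add: add_divide_distrib)
    qed
  qed
  ultimately have "0 + 2 * e \<le> 0"
    by (intro tendsto_upperbound) auto
  then show False using e by simp
qed

text \<open>The upper bound applies to the difference from the chord and to its negative.\<close>

lemma schwarz_affine:
  fixes G :: "real \<Rightarrow> real"
  assumes ab: "a < b" and cont: "continuous_on {a..b} G"
    and lim: "\<And>t. a < t \<Longrightarrow> t < b \<Longrightarrow>
      ((\<lambda>h. (G (t + h) + G (t - h) - 2 * G t) / h\<^sup>2) \<longlongrightarrow> 0) (at_right 0)"
  obtains c d where "\<And>t. t \<in> {a..b} \<Longrightarrow> G t = c * t + d"
proof
  define c where "c = (G b - G a) / (b - a)"
  define d where "d = G a - c * a"
  fix t assume t: "t \<in> {a..b}"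
  have ends: "c * a + d = G a" "c * b + d = G b"
  proof -
    show "c * a + d = G a" by (simp add: d_def)
    have "c * (b - a) = G b - G a" using ab by (simp add: c_def)
    then show "c * b + d = G b" by (simp add: d_def algebra_simps)
  qed
  have "s * (G t - (c * t + d)) \<le> 0" for s
  proof (rule schwarz_upper_bound[where G = "\<lambda>t. s * (G t - (c * t + d))", OF ab])
    show "continuous_on {a..b} (\<lambda>t. s * (G t - (c * t + d)))"
      by (intro continuous_intros cont)
    fix x assume x: "a < x" "x < b"
    have "((\<lambda>h. s * ((G (x + h) + G (x - h) - 2 * G x) / h\<^sup>2)) \<longlongrightarrow> s * 0) (at_right 0)"
      by (intro tendsto_intros lim x)
    then show "((\<lambda>h. (s * (G (x + h) - (c * (x + h) + d)) + s * (G (x - h) - (c * (x - h) + d)) -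
            2 * (s * (G x - (c * x + d)))) / h\<^sup>2) \<longlongrightarrow> 0) (at_right 0)"
      by (simp add: algebra_simps)
  qed (use t ends in auto)
  from this[of 1] this[of "-1"] show "G t = c * t + d" by simp
qed

section \<open>Fourier coefficients of uniformly convergent series and of quadratics\<close>

lemma abs_trig_term_le:
  fixes p q x :: real
  shows "\<bar>p * cos x + q * sin x\<bar> \<le> \<bar>p\<bar> + \<bar>q\<bar>"
proof -
  have "\<bar>p * cos x\<bar> \<le> \<bar>p\<bar> * 1" "\<bar>q * sin x\<bar> \<le> \<bar>q\<bar> * 1"
    unfolding abs_mult by (intro mult_left_mono; simp)+
  then show ?thesis by linarith
qed

lemma has_integral_suminf:
  fixes g :: "nat \<Rightarrow> real \<Rightarrow> real"
  assumes cont: "\<And>k. continuous_on {a..b} (g k)"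
    and bound: "\<And>k t. t \<in> {a..b} \<Longrightarrow> \<bar>g k t\<bar> \<le> M k" and M: "summable M"
    and int: "\<And>k. (g k has_integral I k) {a..b}" and I: "I sums s"
  shows "((\<lambda>t. \<Sum>k. g k t) has_integral s) {a..b}"
proof -
  have "uniform_limit {a..b} (\<lambda>n t. \<Sum>k<n. g k t) (\<lambda>t. \<Sum>k. g k t) sequentially"
    using bound M by (intro Weierstrass_m_test) auto
  then obtain J S where J: "\<And>n. ((\<lambda>t. \<Sum>k<n. g k t) has_integral J n) {a..b}"
    and S: "((\<lambda>t. \<Sum>k. g k t) has_integral S) {a..b}" and lim: "J \<longlonglongrightarrow> S"
    by (rule uniform_limit_integral) (auto intro!: continuous_intros cont)
  have "J n = (\<Sum>k<n. I k)" for n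
    using J[of n] has_integral_sum[of "{..<n}" g I "{a..b}"] int has_integral_unique by blast
  then have "J = (\<lambda>n. \<Sum>k<n. I k)" by blast
  then have "S = s"
    using lim I LIMSEQ_unique unfolding sums_def by blast
  then show ?thesis using S by simp
qed

lemma has_integral_cos_int:
  "((\<lambda>t. cos (of_int j * t)) has_integral (if j = 0 then 2 * pi else 0)) {0..2 * pi}"
proof (cases "j = 0")
  case True
  then show ?thesis using has_integral_const_real[of "1::real" 0 "2 * pi"] by simp
next
  case False
  have "((\<lambda>t. cos (of_int j * t)) has_integral
      (sin (of_int j * (2 * pi)) / of_int j - sin (of_int j * 0) / of_int j)) {0..2 * pi}"
    using False
    by (intro fundamental_theorem_of_calculus)
       (auto intro!: derivative_eq_intros simp flip: has_real_derivative_iff_has_vector_derivative)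
  moreover have "sin (of_int j * (2 * pi)) = 0"
    using sin_int_2pin[of j] by (simp add: mult.commute)
  ultimately show ?thesis using False by simp
qed

lemma has_integral_sin_int:
  "((\<lambda>t. sin (of_int j * t)) has_integral 0) {0..2 * pi}"
proof (cases "j = 0")
  case False
  have "((\<lambda>t. sin (of_int j * t)) has_integral
      (- cos (of_int j * (2 * pi)) / of_int j - - cos (of_int j * 0) / of_int j)) {0..2 * pi}"
    using False
    by (intro fundamental_theorem_of_calculus)
       (auto intro!: derivative_eq_intros simp flip: has_real_derivative_iff_has_vector_derivative)
  moreover have "cos (of_int j * (2 * pi)) = 1"
    using cos_int_2pin[of j] by (simp add: mult.commute)
  ultimately show ?thesis using False by simp
qed simp

lemma trig_orthogonality:
  fixes k m :: nat
  assumes "m \<ge> 1"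
  shows "((\<lambda>t. cos (k * t) * cos (m * t)) has_integral (if k = m then pi else 0)) {0..2 * pi}"
    and "((\<lambda>t. sin (k * t) * cos (m * t)) has_integral 0) {0..2 * pi}"
    and "((\<lambda>t. cos (k * t) * sin (m * t)) has_integral 0) {0..2 * pi}"
    and "((\<lambda>t. sin (k * t) * sin (m * t)) has_integral (if k = m then pi else 0)) {0..2 * pi}"
proof -
  define p q where "p = int k - int m" and "q = int k + int m"
  have pq: "real k * t - real m * t = of_int p * t" "real k * t + real m * t = of_int q * t" for t
    by (simp_all add: p_def q_def algebra_simps)
  have q0: "q \<noteq> 0" and p0: "p = 0 \<longleftrightarrow> k = m" using assms by (auto simp: p_def q_def)
  note cos = has_integral_cos_int[of p] has_integral_cos_int[of q]
  note sin = has_integral_sin_int[of p] has_integral_sin_int[of q]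
  show "((\<lambda>t. cos (k * t) * cos (m * t)) has_integral (if k = m then pi else 0)) {0..2 * pi}"
    using has_integral_divide[OF has_integral_add[OF cos], of 2] q0 p0
    by (auto simp: cos_times_cos pq split: if_splits)
  show "((\<lambda>t. sin (k * t) * sin (m * t)) has_integral (if k = m then pi else 0)) {0..2 * pi}"
    using has_integral_divide[OF has_integral_diff[OF cos], of 2] q0 p0
    by (auto simp: sin_times_sin pq split: if_splits)
  show "((\<lambda>t. sin (k * t) * cos (m * t)) has_integral 0) {0..2 * pi}"
    using has_integral_divide[OF has_integral_add[OF sin(2,1)], of 2]
    by (simp add: sin_times_cos pq)
  show "((\<lambda>t. cos (k * t) * sin (m * t)) has_integral 0) {0..2 * pi}"
    using has_integral_divide[OF has_integral_diff[OF sin(2,1)], of 2]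
    by (simp add: cos_times_sin pq)
qed

lemma fourier_coefficients:
  fixes p q :: "nat \<Rightarrow> real"
  assumes sum: "summable (\<lambda>k. \<bar>p k\<bar>)" "summable (\<lambda>k. \<bar>q k\<bar>)" and m: "m \<ge> 1"
  defines "F \<equiv> (\<lambda>t. \<Sum>k. p k * cos (real k * t) + q k * sin (real k * t))"
  shows "((\<lambda>t. F t * cos (m * t)) has_integral pi * p m) {0..2 * pi}"
    and "((\<lambda>t. F t * sin (m * t)) has_integral pi * q m) {0..2 * pi}"
proof -
  let ?g = "\<lambda>k t. p k * cos (real k * t) + q k * sin (real k * t)"
  have M: "summable (\<lambda>k. \<bar>p k\<bar> + \<bar>q k\<bar>)" by (intro summable_add sum)
  have g: "\<bar>?g k t\<bar> \<le> \<bar>p k\<bar> + \<bar>q k\<bar>" for k t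
    by (rule abs_trig_term_le)
  have gs: "summable (\<lambda>k. ?g k t)" for t
    using g by (intro summable_comparison_test'[OF M, of 0]) auto
  have gw: "\<bar>?g k t * w\<bar> \<le> \<bar>p k\<bar> + \<bar>q k\<bar>" if "\<bar>w\<bar> \<le> 1" for k t w
    unfolding abs_mult[of _ w] using mult_mono[OF g that] by simp
  have F: "F t * w = (\<Sum>k. ?g k t * w)" for t w
    unfolding F_def by (intro suminf_mult2 gs)
  have "((\<lambda>t. \<Sum>k. ?g k t * cos (m * t)) has_integral pi * p m) {0..2 * pi}"
  proof (rule has_integral_suminf[OF _ gw M])
    show "continuous_on {0..2 * pi} (\<lambda>t. ?g k t * cos (m * t))" for k
      by (intro continuous_intros)
    show "((\<lambda>t. ?g k t * cos (m * t)) has_integral (if k = m then pi * p m else 0)) {0..2 * pi}" for k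
    proof -
      have "((\<lambda>t. p k * (cos (k * t) * cos (m * t)) + q k * (sin (k * t) * cos (m * t)))
          has_integral p k * (if k = m then pi else 0) + q k * 0) {0..2 * pi}"
        by (intro has_integral_add has_integral_mult_right trig_orthogonality m)
      then show ?thesis by (auto simp: algebra_simps)
    qed
    show "(\<lambda>k. if k = m then pi * p m else 0) sums (pi * p m)"
      by (rule sums_single)
  qed simp
  then show "((\<lambda>t. F t * cos (m * t)) has_integral pi * p m) {0..2 * pi}"
    by (simp add: F)
  have "((\<lambda>t. \<Sum>k. ?g k t * sin (m * t)) has_integral pi * q m) {0..2 * pi}"
  proof (rule has_integral_suminf[OF _ gw M])
    show "continuous_on {0..2 * pi} (\<lambda>t. ?g k t * sin (m * t))" for k
      by (intro continuous_intros)
    show "((\<lambda>t. ?g k t * sin (m * t)) has_integral (if k = m then pi * q m else 0)) {0..2 * pi}" for k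
    proof -
      have "((\<lambda>t. p k * (cos (k * t) * sin (m * t)) + q k * (sin (k * t) * sin (m * t)))
          has_integral p k * 0 + q k * (if k = m then pi else 0)) {0..2 * pi}"
        by (intro has_integral_add has_integral_mult_right trig_orthogonality m)
      then show ?thesis by (auto simp: algebra_simps)
    qed
    show "(\<lambda>k. if k = m then pi * q m else 0) sums (pi * q m)"
      by (rule sums_single)
  qed simp
  then show "((\<lambda>t. F t * sin (m * t)) has_integral pi * q m) {0..2 * pi}"
    by (simp add: F)
qed

text \<open>The sine coefficients see only the jump of P at the ends of the period, the cosine
  coefficients only the jump of its derivative.\<close>

lemma quadratic_fourier_coefficients:
  fixes A B C :: real and m :: nat
  assumes m: "m \<ge> 1"
  defines "P \<equiv> (\<lambda>t. A * t\<^sup>2 + B * t + C)"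
  shows "((\<lambda>t. P t * cos (m * t)) has_integral 4 * pi * A / m\<^sup>2) {0..2 * pi}"
    and "((\<lambda>t. P t * sin (m * t)) has_integral (P 0 - P (2 * pi)) / m) {0..2 * pi}"
proof -
  have cs: "cos (m * (2 * pi)) = 1" "sin (m * (2 * pi)) = 0"
    using cos_int_2pin[of "int m"] sin_int_2pin[of "int m"] by (simp_all add: mult.commute)
  \<comment> \<open>Antiderivatives obtained by integrating by parts twice.\<close>
  let ?U = "\<lambda>t::real. P t * sin (m * t) / m + (2 * A * t + B) * cos (m * t) / m\<^sup>2
                - 2 * A * sin (m * t) / m ^ 3"
  let ?V = "\<lambda>t::real. - P t * cos (m * t) / m + (2 * A * t + B) * sin (m * t) / m\<^sup>2
                + 2 * A * cos (m * t) / m ^ 3"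
  have "((\<lambda>t. P t * cos (m * t)) has_integral ?U (2 * pi) - ?U 0) {0..2 * pi}"
    using m unfolding P_def
    by (intro fundamental_theorem_of_calculus)
       (auto intro!: derivative_eq_intros
          simp: field_simps power2_eq_square power3_eq_cube
          simp flip: has_real_derivative_iff_has_vector_derivative)
  moreover have "?U (2 * pi) - ?U 0 = 4 * pi * A / m\<^sup>2"
    unfolding cs using m by (simp add: field_simps)
  ultimately show "((\<lambda>t. P t * cos (m * t)) has_integral 4 * pi * A / m\<^sup>2) {0..2 * pi}"
    by simp
  have "((\<lambda>t. P t * sin (m * t)) has_integral ?V (2 * pi) - ?V 0) {0..2 * pi}"
    using m unfolding P_def
    by (intro fundamental_theorem_of_calculus)
       (auto intro!: derivative_eq_intros
          simp: field_simps power2_eq_square power3_eq_cube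
          simp flip: has_real_derivative_iff_has_vector_derivative)
  moreover have "?V (2 * pi) - ?V 0 = (P 0 - P (2 * pi)) / m"
    unfolding cs using m by (simp add: field_simps)
  ultimately show "((\<lambda>t. P t * sin (m * t)) has_integral (P 0 - P (2 * pi)) / m) {0..2 * pi}"
    by simp
qed

section \<open>The Cantor--Lebesgue lemma\<close>

text \<open>The integrand has period pi / k, so its mean over an interval of length pi is exactly
  \<open>(p\<^sup>2 + q\<^sup>2) / 2\<close>. The interval from 1 to 1 + pi lies strictly between 0 and 2 pi, hence avoids
  the points at which convergence may fail.\<close>

lemma has_integral_trig_square:
  fixes k :: nat and p q :: real
  assumes k: "k \<ge> 1"
  shows "((\<lambda>t. (p * cos (k * t) + q * sin (k * t))\<^sup>2) has_integral pi / 2 * (p\<^sup>2 + q\<^sup>2)) {1..1 + pi}"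
proof -
  let ?U = "\<lambda>t::real. (p\<^sup>2 + q\<^sup>2) / 2 * t + (p\<^sup>2 - q\<^sup>2) * sin (2 * k * t) / (4 * k)
                - p * q * cos (2 * k * t) / (2 * k)"
  have eq: "(p * cos x + q * sin x)\<^sup>2 =
      (p\<^sup>2 + q\<^sup>2) / 2 + (p\<^sup>2 - q\<^sup>2) / 2 * cos (2 * x) + p * q * sin (2 * x)" for x
  proof -
    have "2 * (p * cos x + q * sin x)\<^sup>2 = (p\<^sup>2 + q\<^sup>2)
        + (p\<^sup>2 - q\<^sup>2) * ((cos x)\<^sup>2 - (sin x)\<^sup>2) + 2 * (p * q * (2 * sin x * cos x))"
      using sin_cos_squared_add[of x] by algebra
    then have "2 * (p * cos x + q * sin x)\<^sup>2
        = (p\<^sup>2 + q\<^sup>2) + (p\<^sup>2 - q\<^sup>2) * cos (2 * x) + 2 * (p * q * sin (2 * x))"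
      unfolding cos_double sin_double .
    then show ?thesis by (simp add: field_simps)
  qed
  have "((\<lambda>t. (p\<^sup>2 + q\<^sup>2) / 2 + (p\<^sup>2 - q\<^sup>2) / 2 * cos (2 * (k * t)) + p * q * sin (2 * (k * t)))
      has_integral ?U (1 + pi) - ?U 1) {1..1 + pi}"
    using k
    by (intro fundamental_theorem_of_calculus)
       (auto intro!: derivative_eq_intros simp: field_simps
          simp flip: has_real_derivative_iff_has_vector_derivative)
  moreover have "2 * real k * (1 + pi) = 2 * real k + 2 * of_int (int k) * pi"
    by (simp add: algebra_simps)
  then have "cos (2 * real k * (1 + pi)) = cos (2 * real k)"
      "sin (2 * real k * (1 + pi)) = sin (2 * real k)"
    using cos_int_2pin[of "int k"] sin_int_2pin[of "int k"]
    by (simp_all add: cos_add sin_add mult_ac)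
  then have "?U (1 + pi) - ?U 1 = pi / 2 * (p\<^sup>2 + q\<^sup>2)"
    by (simp add: algebra_simps)
  ultimately show ?thesis unfolding eq by (simp only:)
qed

text \<open>Dividing the k-th coefficients by \<open>M k\<close> makes the squared terms bounded by 1
  without affecting convergence to 0, so by dominated convergence their integrals
  \<open>pi / 2 * (p\<^sup>2 + q\<^sup>2)\<close> tend to 0. Smallness of the normalized coefficients p and q carries over to
  a and b because \<open>\<bar>p\<bar> + \<bar>q\<bar> = 1 - 1 / M\<close>: when p and q tend to 0, M tends to 1.\<close>

lemma cantor_lebesgue:
  fixes a b :: "nat \<Rightarrow> real"
  assumes lim: "\<And>t. t \<in> {1..1 + pi} \<Longrightarrow>
      (\<lambda>k. a k * cos (real k * t) + b k * sin (real k * t)) \<longlonglongrightarrow> 0"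
  shows "a \<longlonglongrightarrow> 0" and "b \<longlonglongrightarrow> 0"
proof -
  define M where "M k = 1 + \<bar>a k\<bar> + \<bar>b k\<bar>" for k
  have M: "M k \<ge> 1" for k by (simp add: M_def)
  then have M0: "M k > 0" for k by (rule less_le_trans[OF zero_less_one])
  define p where "p k = a k / M k" for k
  define q where "q k = b k / M k" for k
  have pq: "\<bar>p k\<bar> + \<bar>q k\<bar> = 1 - 1 / M k" for k
  proof -
    have "\<bar>p k\<bar> + \<bar>q k\<bar> = (M k - 1) / M k"
      using M0[of k] by (simp add: p_def q_def abs_divide flip: add_divide_distrib) (simp add: M_def)
    then show ?thesis using M0[of k] by (simp add: diff_divide_distrib)
  qed
  let ?f = "\<lambda>k t. (p k * cos (real k * t) + q k * sin (real k * t))\<^sup>2"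
  have le: "norm (?f k t) \<le> 1" for k t
  proof -
    have "\<bar>p k * cos (real k * t) + q k * sin (real k * t)\<bar> \<le> \<bar>p k\<bar> + \<bar>q k\<bar>"
      by (rule abs_trig_term_le)
    also have "\<dots> \<le> 1" unfolding pq using M0[of k] by simp
    finally show ?thesis by (simp add: abs_square_le_1)
  qed
  have conv: "(\<lambda>k. ?f k t) \<longlonglongrightarrow> 0" if t: "t \<in> {1..1 + pi}" for t
  proof -
    have "(\<lambda>k. p k * cos (real k * t) + q k * sin (real k * t)) \<longlonglongrightarrow> 0"
    proof (rule tendsto_0_le[OF lim[OF t], where K = 1])
      show "\<forall>\<^sub>F k in sequentially. norm (p k * cos (real k * t) + q k * sin (real k * t))
          \<le> norm (a k * cos (real k * t) + b k * sin (real k * t)) * 1"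
      proof (intro always_eventually allI)
        fix k
        have "p k * cos (real k * t) + q k * sin (real k * t)
            = (a k * cos (real k * t) + b k * sin (real k * t)) / M k"
          by (simp add: p_def q_def add_divide_distrib)
        then show "norm (p k * cos (real k * t) + q k * sin (real k * t))
            \<le> norm (a k * cos (real k * t) + b k * sin (real k * t)) * 1"
          using M[of k] M0[of k]
          by (simp add: abs_divide divide_le_eq mult_le_cancel_left1)
      qed
    qed
    from tendsto_power[OF this, of 2] show ?thesis by simp
  qed
  \<comment> \<open>The constant term k = 0 does not oscillate and its integral has a different value,
     hence the shift of the index.\<close>
  have int_lim: "(\<lambda>k. integral {1..1 + pi} (?f (Suc k))) \<longlonglongrightarrow> integral {1..1 + pi} (\<lambda>t. 0)"
  proof (rule dominated_convergence(2)[where h = "\<lambda>t. 1"])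
    show "?f (Suc k) integrable_on {1..1 + pi}" for k
      by (intro integrable_continuous_real continuous_intros)
    show "norm (?f (Suc k) t) \<le> 1" for k t by (rule le)
    show "(\<lambda>k. ?f (Suc k) t) \<longlonglongrightarrow> 0" if "t \<in> {1..1 + pi}" for t
      using LIMSEQ_Suc[OF conv[OF that]] .
  qed (auto intro: integrable_const_ivl)
  have int: "integral {1..1 + pi} (?f (Suc k)) = pi / 2 * ((p (Suc k))\<^sup>2 + (q (Suc k))\<^sup>2)" for k
    by (intro integral_unique has_integral_trig_square) simp
  have "(\<lambda>k. pi / 2 * ((p (Suc k))\<^sup>2 + (q (Suc k))\<^sup>2)) \<longlonglongrightarrow> 0"
    using int_lim unfolding int integral_0 .
  from tendsto_mult[OF tendsto_const this, of "2 / pi"]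
  have "(\<lambda>k. 2 / pi * (pi / 2 * ((p (Suc k))\<^sup>2 + (q (Suc k))\<^sup>2))) \<longlonglongrightarrow> 0"
    by (simp only: mult_zero_right)
  moreover have "2 / pi * (pi / 2 * x) = x" for x :: real by simp
  ultimately have "(\<lambda>k. (p (Suc k))\<^sup>2 + (q (Suc k))\<^sup>2) \<longlonglongrightarrow> 0"
    by (simp only:)
  then have sq: "(\<lambda>k. (p k)\<^sup>2 + (q k)\<^sup>2) \<longlonglongrightarrow> 0"
    by (rule LIMSEQ_imp_Suc)
  have "(\<lambda>k. (p k)\<^sup>2) \<longlonglongrightarrow> 0" "(\<lambda>k. (q k)\<^sup>2) \<longlonglongrightarrow> 0"
    by (rule tendsto_0_le[OF sq, where K = 1]; simp)+
  then have p: "p \<longlonglongrightarrow> 0" and q: "q \<longlonglongrightarrow> 0"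
    using tendsto_real_sqrt[of "\<lambda>k. (p k)\<^sup>2" 0 sequentially]
          tendsto_real_sqrt[of "\<lambda>k. (q k)\<^sup>2" 0 sequentially]
    by (simp_all add: tendsto_rabs_zero_iff)
  have "(\<lambda>k. 1 - (\<bar>p k\<bar> + \<bar>q k\<bar>)) \<longlonglongrightarrow> 1 - (\<bar>0\<bar> + \<bar>0\<bar>)"
    by (intro tendsto_intros p q)
  then have d: "(\<lambda>k. 1 / M k) \<longlonglongrightarrow> 1" by (simp add: pq)
  have "(\<lambda>k. p k / (1 / M k)) \<longlonglongrightarrow> 0 / 1" "(\<lambda>k. q k / (1 / M k)) \<longlonglongrightarrow> 0 / 1"
    by (intro tendsto_divide p q d; simp)+
  moreover have "p k / (1 / M k) = a k" "q k / (1 / M k) = b k" for k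
    using M0[of k] by (simp_all add: p_def q_def)
  ultimately show "a \<longlonglongrightarrow> 0" "b \<longlonglongrightarrow> 0" by simp_all
qed

section \<open>Cantor's uniqueness theorem\<close>

text \<open>The identities cos (x + 2 y) + cos (x - 2 y) - 2 cos x = -4 cos x (sin y)^2, and
  likewise for sin, produce the kernel for \<open>k \<ge> 1\<close>. The constant term of the series is
  carried by the quadratic part of G, since the term of the sum with index 0 is 0 by the convention
  on division by 0.\<close>

lemma riemann_second_difference:
  fixes a b :: "nat \<Rightarrow> real" and t h :: real
  assumes h: "h > 0"
    and summ: "\<And>t. summable (\<lambda>k. a k / real k ^ 2 * cos (real k * t) + b k / real k ^ 2 * sin (real k * t))"
  defines "G \<equiv> (\<lambda>t. a 0 / 2 * t\<^sup>2 -
      (\<Sum>k. a k / real k ^ 2 * cos (real k * t) + b k / real k ^ 2 * sin (real k * t)))"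
  shows "(\<lambda>k. (a k * cos (real k * t) + b k * sin (real k * t)) * riemann_kernel (real k * h))
    sums ((G (t + 2 * h) + G (t - 2 * h) - 2 * G t) / (2 * h)\<^sup>2)"
proof -
  define g where "g k t = a k / real k ^ 2 * cos (real k * t) + b k / real k ^ 2 * sin (real k * t)"
    for k t
  define F where "F t = (\<Sum>k. g k t)" for t
  have g: "(\<lambda>k. g k t) sums F t" for t
    unfolding F_def g_def by (intro summable_sums summ)
  have "(\<lambda>k. (if k = 0 then a 0 else 0) - (g k (t + 2 * h) + g k (t - 2 * h) - 2 * g k t) / (2 * h)\<^sup>2)
     sums (a 0 - (F (t + 2 * h) + F (t - 2 * h) - 2 * F t) / (2 * h)\<^sup>2)"
    by (intro sums_diff sums_add sums_divide sums_mult g sums_single)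
  moreover have "(if k = 0 then a 0 else 0) - (g k (t + 2 * h) + g k (t - 2 * h) - 2 * g k t) / (2 * h)\<^sup>2
     = (a k * cos (real k * t) + b k * sin (real k * t)) * riemann_kernel (real k * h)" for k
  proof (cases "k = 0")
    case True
    then show ?thesis by (simp add: g_def)
  next
    case False
    define x y where "x = real k * t" and "y = real k * h"
    have args: "real k * (t + 2 * h) = x + 2 * y" "real k * (t - 2 * h) = x - 2 * y"
      by (simp_all add: x_def y_def algebra_simps)
    have y: "y \<noteq> 0" "y = real k * h" using False h by (simp_all add: y_def)
    have "g k (t + 2 * h) + g k (t - 2 * h) - 2 * g k t =
       (a k * (cos (x + 2 * y) + cos (x - 2 * y) - 2 * cos x)
        + b k * (sin (x + 2 * y) + sin (x - 2 * y) - 2 * sin x)) / real k ^ 2"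
      unfolding g_def args x_def[symmetric] by (simp add: add_divide_distrib diff_divide_distrib algebra_simps)
    also have "\<dots> = - 4 * (a k * cos x + b k * sin x) * (sin y)\<^sup>2 / real k ^ 2"
    proof -
      have second: "cos (x + 2 * y) + cos (x - 2 * y) - 2 * cos x = - 4 * cos x * (sin y)\<^sup>2"
        "sin (x + 2 * y) + sin (x - 2 * y) - 2 * sin x = - 4 * sin x * (sin y)\<^sup>2"
        unfolding cos_add cos_diff sin_add sin_diff cos_double_sin by (simp_all add: algebra_simps)
      show ?thesis unfolding second by (simp add: algebra_simps)
    qed
    finally show ?thesis
      using False h y(1) by (simp add: riemann_kernel_def flip: x_def y_def)
        (simp add: y_def field_simps)
  qed
  moreover have "a 0 - (F (t + 2 * h) + F (t - 2 * h) - 2 * F t) / (2 * h)\<^sup>2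
     = (G (t + 2 * h) + G (t - 2 * h) - 2 * G t) / (2 * h)\<^sup>2"
  proof -
    have G: "G s = a 0 / 2 * s\<^sup>2 - F s" for s by (simp add: G_def F_def g_def)
    have "G (t + 2 * h) + G (t - 2 * h) - 2 * G t =
        a 0 * (2 * h)\<^sup>2 - (F (t + 2 * h) + F (t - 2 * h) - 2 * F t)"
      unfolding G by (simp add: power2_eq_square field_simps)
    then show ?thesis using h by (simp add: diff_divide_distrib)
  qed
  ultimately show ?thesis by simp
qed

text \<open>Convergence may fail at the multiples of 2 pi, so G is known to be affine only between
  them. This already expresses all Fourier coefficients of F except the mean in terms of a 0. The
  usual argument that G has no corner at 0 is replaced by the fact that a tends to 0.\<close>

theorem cantor_uniqueness:
  fixes a b :: "nat \<Rightarrow> real"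
  assumes conv: "\<And>t. 0 < t \<Longrightarrow> t < 2 * pi \<Longrightarrow>
      (\<lambda>k. a k * cos (real k * t) + b k * sin (real k * t)) sums 0"
  shows "a k = 0" and "k \<ge> 1 \<Longrightarrow> b k = 0"
proof -
  have "(\<lambda>k. a k * cos (real k * t) + b k * sin (real k * t)) \<longlonglongrightarrow> 0"
    if "t \<in> {1..1 + pi}" for t
    using that pi_gt3 by (intro summable_LIMSEQ_zero sums_summable[OF conv]) auto
  then have a: "a \<longlonglongrightarrow> 0" and b: "b \<longlonglongrightarrow> 0"
    by (rule cantor_lebesgue[of a b]; simp)+
  define p q where "p k = a k / real k ^ 2" and "q k = b k / real k ^ 2" for k
  have abs_summable: "summable (\<lambda>k. \<bar>c k / real k ^ 2\<bar>)" if "c \<longlonglongrightarrow> 0" for c :: "nat \<Rightarrow> real"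
  proof -
    have "Bseq c" using that by (auto intro: convergent_imp_Bseq convergentI)
    then obtain B where B: "\<And>k. \<bar>c k\<bar> \<le> B" by (auto simp: Bseq_def)
    have "summable (\<lambda>k. B * inverse (real k ^ 2))"
      by (intro summable_mult inverse_power_summable) simp
    then show ?thesis
      by (rule summable_comparison_test'[of _ 0])
         (use B in \<open>auto simp: abs_mult divide_inverse intro!: mult_right_mono\<close>)
  qed
  have p: "summable (\<lambda>k. \<bar>p k\<bar>)" and q: "summable (\<lambda>k. \<bar>q k\<bar>)"
    unfolding p_def q_def by (intro abs_summable a b)+
  define g where "g k t = p k * cos (real k * t) + q k * sin (real k * t)" for k t
  define F where "F t = (\<Sum>k. g k t)" for t
  have M: "summable (\<lambda>k. \<bar>p k\<bar> + \<bar>q k\<bar>)" by (intro summable_add p q)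
  have g: "norm (g k t) \<le> \<bar>p k\<bar> + \<bar>q k\<bar>" for k t
    unfolding g_def real_norm_def by (rule abs_trig_term_le)
  have gs: "summable (\<lambda>k. g k t)" for t
    by (rule summable_comparison_test'[OF M, of 0]) (rule g)
  have "uniform_limit UNIV (\<lambda>n t. \<Sum>k<n. g k t) F sequentially"
    unfolding F_def by (intro Weierstrass_m_test[OF _ M] g)
  then have F_cont: "continuous_on UNIV F"
    by (rule uniform_limit_theorem[rotated])
       (auto simp: g_def intro!: always_eventually continuous_intros)
  define G where "G t = a 0 / 2 * t\<^sup>2 - F t" for t
  have G_cont: "continuous_on S G" for S
    unfolding G_def by (intro continuous_intros continuous_on_subset[OF F_cont]) auto
  have lim: "((\<lambda>h. (G (t + h) + G (t - h) - 2 * G t) / h\<^sup>2) \<longlongrightarrow> 0) (at_right 0)"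
    if t: "0 < t" "t < 2 * pi" for t
  proof -
    have "((\<lambda>h. (G (t + 2 * h) + G (t - 2 * h) - 2 * G t) / (2 * h)\<^sup>2) \<longlongrightarrow> 0) (at_right 0)"
    proof (rule riemann_summation[OF conv[OF t]])
      fix h :: real assume "h > 0"
      from riemann_second_difference[OF this, of a b t] gs
      show "(\<lambda>k. (a k * cos (real k * t) + b k * sin (real k * t)) * riemann_kernel (real k * h))
          sums ((G (t + 2 * h) + G (t - 2 * h) - 2 * G t) / (2 * h)\<^sup>2)"
        by (simp add: G_def F_def g_def p_def q_def)
    qed
    moreover have "filterlim (\<lambda>h. h / 2) (at_right 0) (at_right (0::real))"
      using eventually_at_right_less[of "0::real"]
      by (auto simp: filterlim_at elim: eventually_mono intro!: tendsto_eq_intros)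
    ultimately have "((\<lambda>h. (G (t + 2 * (h / 2)) + G (t - 2 * (h / 2)) - 2 * G t) / (2 * (h / 2))\<^sup>2)
        \<longlongrightarrow> 0) (at_right 0)"
      by (rule filterlim_compose)
    then show ?thesis by simp
  qed
  obtain c d where G: "\<And>t. t \<in> {0..2 * pi} \<Longrightarrow> G t = c * t + d"
    using schwarz_affine[OF _ G_cont lim] by (metis pi_gt_zero mult_pos_pos zero_less_numeral)
  define P where "P t = a 0 / 2 * t\<^sup>2 + (- c) * t + (- d)" for t
  have FP: "F t = P t" if "t \<in> {0..2 * pi}" for t
    using G[OF that] by (simp add: G_def P_def)
  have "F (2 * pi) = F 0"
  proof -
    have "g k (2 * pi) = g k 0" for k
      using cos_int_2pin[of "int k"] sin_int_2pin[of "int k"] by (simp add: g_def mult.commute)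
    then show ?thesis by (simp add: F_def)
  qed
  then have P_per: "P 0 = P (2 * pi)" using FP[of 0] FP[of "2 * pi"] by simp
  have coeff: "a m = 2 * a 0" "b m = 0" if m: "m \<ge> 1" for m
  proof -
    note fc = fourier_coefficients[OF p q m, folded g_def, folded F_def]
    note qc = quadratic_fourier_coefficients[OF m, of "a 0 / 2" "- c" "- d", folded P_def]
    have "((\<lambda>t. F t * cos (m * t)) has_integral 4 * pi * (a 0 / 2) / m\<^sup>2) {0..2 * pi}"
      using qc(1) by (rule has_integral_eq[rotated]) (simp add: FP)
    then have "pi * p m = 4 * pi * (a 0 / 2) / m\<^sup>2"
      using fc(1) has_integral_unique by blast
    then show "a m = 2 * a 0" using m by (simp add: p_def)
    have "((\<lambda>t. F t * sin (m * t)) has_integral (P 0 - P (2 * pi)) / m) {0..2 * pi}"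
      using qc(2) by (rule has_integral_eq[rotated]) (simp add: FP)
    then have "pi * q m = (P 0 - P (2 * pi)) / m"
      using fc(2) has_integral_unique by blast
    then show "b m = 0" using m P_per by (simp add: q_def)
  qed
  have "eventually (\<lambda>m. a m = 2 * a 0) sequentially"
    using coeff(1) by (auto simp: eventually_sequentially)
  then have "a \<longlonglongrightarrow> 2 * a 0" by (rule tendsto_eventually)
  then have "a 0 = 0" using a LIMSEQ_unique by fastforce
  then show "a k = 0" using coeff(1)[of k] by (cases "k = 0") auto
  show "b k = 0" if "k \<ge> 1" using coeff(2)[OF that] .
qed

section \<open>Averaging a Fourier series over translates\<close>

lemma sum_cis_translates:
  assumes a: "a > 0"
  shows "(\<Sum>j<a. cis (2 * pi * real k * (x + real j / real a)))
       = (if a dvd k then of_nat a * cis (2 * pi * real k * x) else 0)"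
proof -
  define w where "w = cis (2 * pi * real k / real a)"
  have w_pow: "w ^ j = cis (2 * pi * real k * (real j / real a))" for j
    by (simp add: w_def Complex.DeMoivre mult_ac)
  have split: "cis (2 * pi * real k * (x + real j / real a)) = cis (2 * pi * real k * x) * w ^ j" for j
    unfolding w_pow by (simp add: cis_mult distrib_left)
  have sum: "(\<Sum>j<a. cis (2 * pi * real k * (x + real j / real a)))
      = cis (2 * pi * real k * x) * (\<Sum>j<a. w ^ j)"
    unfolding split by (rule sum_distrib_left[symmetric])
  show ?thesis
  proof (cases "a dvd k")
    case True
    then obtain m where "k = a * m" ..
    then have "2 * pi * real k / real a = 2 * pi * real m" using a by simp
    then have "w = 1" unfolding w_def by (simp add: cis_multiple_2pi)
    then show ?thesis using True by (simp add: sum)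
  next
    case False
    have "w \<noteq> 1"
    proof
      assume "w = 1"
      then have "cos (2 * pi * real k / real a) = 1"
        unfolding w_def by (metis cis.sel(1) one_complex.sel(1))
      then obtain n :: int where "2 * pi * real k / real a = of_int n * 2 * pi"
        by (auto simp: cos_one_2pi_int)
      then have "real k = of_int n * real a" using a by (simp add: field_simps)
      then have "real_of_int (int k) = real_of_int (n * int a)" by simp
      then have "int k = n * int a" by (simp only: of_int_eq_iff)
      then have "int a dvd int k" by simp
      with False show False by simp
    qed
    moreover have "w ^ a = 1"
      unfolding w_pow using a cis_multiple_2pi[of "real k"] by simp
    ultimately have "(\<Sum>j<a. w ^ j) = 0"
      by (simp add: geometric_sum)
    then show ?thesis using False by (simp add: sum)
  qed
qed

lemma sum_cos_translates:
  assumes "a > 0"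
  shows "(\<Sum>j<a. cos (2 * pi * real k * (x + real j / real a)))
       = (if a dvd k then real a * cos (2 * pi * real k * x) else 0)"
  using arg_cong[OF sum_cis_translates[OF assms, of k x], of Re] by (simp add: Re_sum split: if_splits)

lemma sum_sin_translates:
  assumes "a > 0"
  shows "(\<Sum>j<a. sin (2 * pi * real k * (x + real j / real a)))
       = (if a dvd k then real a * sin (2 * pi * real k * x) else 0)"
  using arg_cong[OF sum_cis_translates[OF assms, of k x], of Im] by (simp add: Im_sum split: if_splits)

text \<open>Only the frequencies k = a m survive the averaging, and k x = m (a x) makes the
  result a series in a x.\<close>

lemma sums_average_translates:
  fixes A B :: "nat \<Rightarrow> real"
  assumes a: "a > 0"
    and f: "\<And>j. j < a \<Longrightarrow>
      (\<lambda>k. A k * cos (2 * pi * real k * (x + real j / real a))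
         + B k * sin (2 * pi * real k * (x + real j / real a))) sums f (x + real j / real a)"
  shows "(\<lambda>m. real a * (A (a * m) * cos (2 * pi * real m * (real a * x))
                       + B (a * m) * sin (2 * pi * real m * (real a * x))))
         sums (\<Sum>j<a. f (x + real j / real a))"
proof -
  let ?h = "\<lambda>k. if a dvd k
      then real a * (A k * cos (2 * pi * real k * x) + B k * sin (2 * pi * real k * x)) else 0"
  have "(\<lambda>k. \<Sum>j<a. A k * cos (2 * pi * real k * (x + real j / real a))
         + B k * sin (2 * pi * real k * (x + real j / real a))) sums (\<Sum>j<a. f (x + real j / real a))"
    using f by (intro sums_sum) auto
  moreover have "(\<Sum>j<a. A k * cos (2 * pi * real k * (x + real j / real a))
         + B k * sin (2 * pi * real k * (x + real j / real a))) = ?h k" for k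
    unfolding sum.distrib sum_distrib_left[symmetric] sum_cos_translates[OF a] sum_sin_translates[OF a]
    by (simp add: algebra_simps)
  ultimately have "?h sums (\<Sum>j<a. f (x + real j / real a))" by simp
  moreover have "(\<lambda>m. ?h (a * m)) sums s \<longleftrightarrow> ?h sums s" for s
    using a by (intro sums_mono_reindex) (auto simp: strict_mono_def dvd_def)
  ultimately have "(\<lambda>m. ?h (a * m)) sums (\<Sum>j<a. f (x + real j / real a))" by blast
  moreover have "?h (a * m) = real a * (A (a * m) * cos (2 * pi * real m * (real a * x))
                       + B (a * m) * sin (2 * pi * real m * (real a * x)))" for m
    by (simp add: mult_ac)
  ultimately show ?thesis by (simp only:)
qed

section \<open>The functional equation\<close>

text \<open>Since f is real, the real part of a symmetric partial sum also converges to f; pairing the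
  frequencies k and -k in it gives the ordinary partial sums of a cosine and sine series.\<close>

lemma real_fourier_expansion:
  assumes "fourier_expandable_on D f"
  obtains A B :: "nat \<Rightarrow> real" where
    "\<And>x. x \<in> D \<Longrightarrow> (\<lambda>k. A k * cos (2 * pi * real k * x) + B k * sin (2 * pi * real k * x)) sums f x"
proof -
  obtain \<alpha> :: "int \<Rightarrow> complex" where \<alpha>: "\<And>x. x \<in> D \<Longrightarrow>
      (\<lambda>N. \<Sum>k = - int N..int N. \<alpha> k * exp (2 * pi * \<i> * of_int k * of_real x))
        \<longlonglongrightarrow> complex_of_real (f x)"
    using assms unfolding fourier_expandable_on_def by blast
  \<comment> \<open>The frequencies k and -k coincide for k = 0, so \<open>\<alpha> 0\<close> is counted once.\<close>
  define A where "A k = (if k = 0 then Re (\<alpha> 0) else Re (\<alpha> (int k)) + Re (\<alpha> (- int k)))" for k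
  define B where "B k = Im (\<alpha> (- int k)) - Im (\<alpha> (int k))" for k
  have "(\<lambda>k. A k * cos (2 * pi * real k * x) + B k * sin (2 * pi * real k * x)) sums f x"
    if x: "x \<in> D" for x
  proof -
    let ?e = "\<lambda>k. \<alpha> k * exp (2 * pi * \<i> * of_int k * of_real x)"
    have Re_e: "Re (?e k) = Re (\<alpha> k) * cos (2 * pi * of_int k * x) - Im (\<alpha> k) * sin (2 * pi * of_int k * x)"
      for k
    proof -
      have "exp (2 * pi * \<i> * of_int k * of_real x) = cis (2 * pi * of_int k * x)"
        by (simp add: cis_conv_exp mult_ac)
      then show ?thesis by simp
    qed
    have "Re (\<Sum>k = - int N..int N. ?e k)
        = (\<Sum>k<Suc N. A k * cos (2 * pi * real k * x) + B k * sin (2 * pi * real k * x))" for N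
    proof (induction N)
      case 0
      show ?case by (simp add: Re_e A_def)
    next
      case (Suc N)
      have "{- int (Suc N)..int (Suc N)}
          = insert (- int (Suc N)) (insert (int (Suc N)) {- int N..int N})" by auto
      then have "(\<Sum>k = - int (Suc N)..int (Suc N). ?e k)
          = ?e (- int (Suc N)) + (?e (int (Suc N)) + (\<Sum>k = - int N..int N. ?e k))"
        by (simp del: of_nat_Suc)
      moreover have "Re (?e (- int (Suc N))) + Re (?e (int (Suc N)))
          = A (Suc N) * cos (2 * pi * real (Suc N) * x) + B (Suc N) * sin (2 * pi * real (Suc N) * x)"
        unfolding Re_e by (simp add: A_def B_def algebra_simps del: of_nat_Suc)
      ultimately show ?case
        using Suc.IH by (simp del: of_nat_Suc)
    qed
    with tendsto_Re[OF \<alpha>[OF x]]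
    have "(\<lambda>N. \<Sum>k<Suc N. A k * cos (2 * pi * real k * x) + B k * sin (2 * pi * real k * x))
        \<longlonglongrightarrow> f x" by simp
    then show ?thesis unfolding sums_def by (rule LIMSEQ_imp_Suc)
  qed
  then show ?thesis by (rule that)
qed

lemma admissible_translates:
  assumes D: "admissible_domain n D" and a: "a > 0" and x: "real a * x \<in> D"
  shows "x + real j / real a \<in> D"
proof (cases "D = UNIV")
  case False
  then have D: "D = - \<int>" using D by (simp add: admissible_domain_def)
  have "x + real j / real a \<notin> \<int>"
  proof
    assume "x + real j / real a \<in> \<int>"
    then have "real a * (x + real j / real a) - real j \<in> \<int>" by simp
    moreover have "real a * (x + real j / real a) - real j = real a * x"
      using a by (simp add: field_simps)
    ultimately show False using x D by simp
  qed
  then show ?thesis using D by simp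
qed simp

text \<open>The functional equation in terms of coefficients: both sides are trigonometric series in
  a x, and Cantor's theorem allows their coefficients to be compared. The case m = 0 of the
  comparison reads \<open>A 0 = a ^ n * A 0\<close>, which forces \<open>A 0 = 0\<close> because \<open>a ^ n > 1\<close>.\<close>

theorem fourier_solves_iff:
  fixes n a :: nat and A B :: "nat \<Rightarrow> real"
  assumes n: "n \<ge> 1" and a: "a \<ge> 2" and D: "admissible_domain n D"
    and f: "\<And>x. x \<in> D \<Longrightarrow>
      (\<lambda>k. A k * cos (2 * pi * real k * x) + B k * sin (2 * pi * real k * x)) sums f x"
  shows "solves_equation n a D f \<longleftrightarrow>
    A 0 = 0 \<and> (\<forall>m\<ge>1. A m = real a ^ n * A (a * m) \<and> B m = real a ^ n * B (a * m))"
proof -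
  have a0: "a > 0" using a by simp
  have pow: "real a ^ n = real a ^ (n - 1) * real a"
    using n by (cases n) (auto simp: mult.commute)
  have range: "{0..a - 1} = {..<a}" using a0 by auto
  have rhs: "(\<lambda>m. real a ^ n * A (a * m) * cos (2 * pi * real m * (real a * x))
                + real a ^ n * B (a * m) * sin (2 * pi * real m * (real a * x)))
         sums (real a ^ (n - 1) * (\<Sum>j = 0..a - 1. f (x + real j / real a)))"
    if x: "real a * x \<in> D" for x
  proof -
    have "(\<lambda>m. real a * (A (a * m) * cos (2 * pi * real m * (real a * x))
                       + B (a * m) * sin (2 * pi * real m * (real a * x))))
         sums (\<Sum>j<a. f (x + real j / real a))"
      by (rule sums_average_translates[OF a0 f[OF admissible_translates[OF D a0 x]]])
    from sums_mult[OF this, of "real a ^ (n - 1)"] show ?thesis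
      unfolding pow range by (simp add: algebra_simps)
  qed
  show ?thesis
  proof
    assume eq: "solves_equation n a D f"
    define p where "p m = A m - real a ^ n * A (a * m)" for m
    define q where "q m = B m - real a ^ n * B (a * m)" for m
    have zero: "(\<lambda>m. p m * cos (real m * t) + q m * sin (real m * t)) sums 0"
      if t: "0 < t" "t < 2 * pi" for t
    proof -
      define y where "y = t / (2 * pi)"
      have y: "0 < y" "y < 1" using t by (simp_all add: y_def field_simps)
      then have "y \<notin> \<int>" by (auto elim!: Ints_cases)
      then have yD: "y \<in> D"
        using D by (auto simp: admissible_domain_def)
      have ay: "real a * (y / real a) = y" using a0 by simp
      have ty: "2 * pi * real m * y = real m * t" for m by (simp add: y_def)
      have "f y = real a ^ (n - 1) * (\<Sum>k = 0..a - 1. f (y / real a + real k / real a))"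
        using eq yD ay unfolding solves_equation_def by metis
      with rhs[of "y / real a"] yD
      have "(\<lambda>m. real a ^ n * A (a * m) * cos (2 * pi * real m * y)
                + real a ^ n * B (a * m) * sin (2 * pi * real m * y)) sums f y"
        unfolding ay by simp
      from sums_diff[OF f[OF yD] this] show ?thesis
        unfolding ty by (simp add: p_def q_def algebra_simps)
    qed
    have "p 0 = 0" by (rule cantor_uniqueness(1)[OF zero])
    then have "A 0 * (1 - real a ^ n) = 0" by (simp add: p_def algebra_simps)
    moreover have "real a ^ n > 1" using n a by (intro one_less_power) auto
    ultimately have "A 0 = 0" by simp
    moreover have "A m = real a ^ n * A (a * m)" for m
      using cantor_uniqueness(1)[OF zero, of m] by (simp add: p_def)
    moreover have "B m = real a ^ n * B (a * m)" if "m \<ge> 1" for m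
      using cantor_uniqueness(2)[OF zero that] by (simp add: q_def)
    ultimately show "A 0 = 0 \<and> (\<forall>m\<ge>1. A m = real a ^ n * A (a * m) \<and> B m = real a ^ n * B (a * m))"
      by blast
  next
    assume rel: "A 0 = 0 \<and> (\<forall>m\<ge>1. A m = real a ^ n * A (a * m) \<and> B m = real a ^ n * B (a * m))"
    show "solves_equation n a D f"
      unfolding solves_equation_def
    proof (intro allI impI)
      fix x assume x: "real a * x \<in> D"
      have "A m * cos (2 * pi * real m * (real a * x)) + B m * sin (2 * pi * real m * (real a * x))
          = real a ^ n * A (a * m) * cos (2 * pi * real m * (real a * x))
                + real a ^ n * B (a * m) * sin (2 * pi * real m * (real a * x))" for m
        using rel by (cases "m = 0") auto
      with rhs[OF x] f[OF x]
      show "f (real a * x) = real a ^ (n - 1) * (\<Sum>k = 0..a - 1. f (x + real k / real a))"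
        by (simp add: sums_unique2)
    qed
  qed
qed

theorem theorem3p8:
  fixes n a :: nat and D :: "real set" and f :: "real \<Rightarrow> real"
  assumes "n \<ge> 1" and "a \<ge> 2"
    and "admissible_domain n D"
    and "one_periodic_on D f"
    and "fourier_expandable_on D f"
  shows "solves_equation n a D f \<longleftrightarrow>
    (\<exists>u v :: nat \<Rightarrow> real.
       (\<forall>k\<ge>1. u (a * k) = u k \<and> v (a * k) = v k) \<and>
       (\<forall>x\<in>D. (\<lambda>j. let k = Suc j in
            u k * (cos (2 * pi * real k * x) / real k ^ n) +
            v k * (sin (2 * pi * real k * x) / real k ^ n)) sums f x))"
    (is "_ \<longleftrightarrow> ?form")
proof
  assume eq: "solves_equation n a D f"
  obtain A B :: "nat \<Rightarrow> real" where AB: "\<And>x. x \<in> D \<Longrightarrow>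
      (\<lambda>k. A k * cos (2 * pi * real k * x) + B k * sin (2 * pi * real k * x)) sums f x"
    using real_fourier_expansion[OF assms(5)] by blast
  have A0: "A 0 = 0" and rel: "\<And>m. m \<ge> 1 \<Longrightarrow> A m = real a ^ n * A (a * m) \<and> B m = real a ^ n * B (a * m)"
    using eq fourier_solves_iff[OF assms(1-3) AB] by auto
  define u v where "u k = real k ^ n * A k" and "v k = real k ^ n * B k" for k
  show ?form
  proof (intro exI conjI ballI allI impI)
    fix k :: nat assume "k \<ge> 1"
    then show "u (a * k) = u k" "v (a * k) = v k"
      using rel[of k] by (simp_all add: u_def v_def power_mult_distrib)
  next
    fix x assume "x \<in> D"
    from AB[OF this] A0
    have "(\<lambda>k. A (Suc k) * cos (2 * pi * real (Suc k) * x) + B (Suc k) * sin (2 * pi * real (Suc k) * x)) sums f x"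
      by (subst sums_Suc_iff) simp
    then show "(\<lambda>j. let k = Suc j in u k * (cos (2 * pi * real k * x) / real k ^ n) +
            v k * (sin (2 * pi * real k * x) / real k ^ n)) sums f x"
      by (simp add: Let_def u_def v_def del: of_nat_Suc)
  qed
next
  assume ?form
  then obtain u v :: "nat \<Rightarrow> real" where
    uv: "\<And>k. k \<ge> 1 \<Longrightarrow> u (a * k) = u k \<and> v (a * k) = v k"
    and f: "\<And>x. x \<in> D \<Longrightarrow> (\<lambda>j. let k = Suc j in
            u k * (cos (2 * pi * real k * x) / real k ^ n) +
            v k * (sin (2 * pi * real k * x) / real k ^ n)) sums f x"
    by blast
  define A where "A k = u k / real k ^ n" for k
  define B where "B k = v k / real k ^ n" for k
  have A0: "A 0 = 0" using assms(1) by (simp add: A_def)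
  have "(\<lambda>k. A k * cos (2 * pi * real k * x) + B k * sin (2 * pi * real k * x)) sums f x"
    if "x \<in> D" for x
  proof -
    have "(\<lambda>k. A (Suc k) * cos (2 * pi * real (Suc k) * x) + B (Suc k) * sin (2 * pi * real (Suc k) * x)) sums f x"
      using f[OF that] by (simp add: Let_def A_def B_def del: of_nat_Suc)
    then show ?thesis by (subst (asm) sums_Suc_iff) (simp add: A0)
  qed
  from fourier_solves_iff[OF assms(1-3) this] show "solves_equation n a D f"
    using A0 uv assms(2) by (simp add: A_def B_def power_mult_distrib)
qed

end
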